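(* For all integers $n\ge k\ge1$, the triples of statistics $$(\mathrm{MAK},\mathrm{MAK}',\mathrm{bDES})\quad\text{and}\quad(\mathrm{MAK}',\mathrm{MAK},\mathrm{bDES})$$ are equidistributed over $\mathcal{OP}_n^k$; that is, for all integers $a,b$ and every set $S$ of positive integers, the number of $\pi\in\mathcal{OP}_n^k$ with $(\mathrm{MAK}\,\pi,\mathrm{MAK}'\,\pi,\mathrm{bDES}(\pi))=(a,b,S)$ equals the number of $\pi\in\mathcal{OP}_n^k$ with $(\mathrm{MAK}'\,\pi,\mathrm{MAK}\,\pi,\mathrm{bDES}(\pi))=(a,b,S)$.
   Context: $\mathcal{OP}_n^k$ is the set of ordered set partitions $\pi=B_1|B_2|\cdots|B_k$ of $\{1,\ldots,n\}$ into $k$ blocks: sequences of $k$ pairwise disjoint nonempty subsets whose union is $\{1,\ldots,n\}$. For $\pi=B_1|\cdots|B_k\in\mathcal{OP}_n^k$: - $\mathrm{bDES}(\pi)$ is the set of block descents, i.e. of $i$ with $1\le i\le k-1$ such that every element of $B_i$ is larger than every element of $B_{i+1}$. - The opener of a block is its least element, the closer its greatest element; $\mathrm{Open}(\pi)$ and $\mathrm{Clos}(\pi)$ are the sets of openers and closers of the blocks of $\pi$. - For $1\le i\le n$, $\mathrm{rsb}_i\,\pi$ is the number of blocks $B$ of $\pi$ lying to the right of the block containing $i$ such that the opener of $B$ is smaller than $i$ and the closer of $B$ is greater than $i$; $\mathrm{rsb}\,\pi=\sum_{i=1}^n\mathrm{rsb}_i\,\pi$. - $\mathrm{MAK}\,\pi=\mathrm{rsb}\,\pi+\sum_{i\in\mathrm{Clos}(\pi)}(n-i)$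 and $\mathrm{MAK}'\,\pi=\mathrm{rsb}\,\pi+\sum_{i\in\mathrm{Open}(\pi)}(i-1)$. *)

theory Defs
  imports Main "HOL-Library.Disjoint_Sets"
begin

text \<open>
  The ordered set partition \<open>B\<^sub>1|\<dots>|B\<^sub>k\<close> is the list \<open>[B\<^sub>1, \<dots>, B\<^sub>k]\<close>. Lists are indexed
  from 0, so the block \<open>B\<^sub>i\<close> is \<open>\<pi> ! (i - 1)\<close>.
\<close>

definition OP :: "nat \<Rightarrow> nat \<Rightarrow> nat set list set" where
  "OP n k = {\<pi>. length \<pi> = k \<and> distinct \<pi> \<and> partition_on {1..n} (set \<pi>)}"

lemma finite_OP: "finite (OP n k)"
proof (rule finite_subset)
  show "OP n k \<subseteq> {\<pi>. set \<pi> \<subseteq> Pow {1..n} \<and> length \<pi> = k}"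
    by (auto simp: OP_def partition_on_def)
  show "finite {\<pi>. set \<pi> \<subseteq> Pow {1..n} \<and> length \<pi> = k}"
    by (rule finite_lists_length_eq) simp
qed

definition bDES :: "nat set list \<Rightarrow> nat set" where
  "bDES \<pi> = {i. 1 \<le> i \<and> i < length \<pi> \<and> (\<forall>x\<in>\<pi> ! (i - 1). \<forall>y\<in>\<pi> ! i. x > y)}"

definition opener :: "nat set \<Rightarrow> nat" where
  "opener B = Min B"

definition closer :: "nat set \<Rightarrow> nat" where
  "closer B = Max B"

definition Open :: "nat set list \<Rightarrow> nat set" where
  "Open \<pi> = opener ` set \<pi>"

definition Clos :: "nat set list \<Rightarrow> nat set" where
  "Clos \<pi> = closer ` set \<pi>"

definition rsb_at :: "nat \<Rightarrow> nat set list \<Rightarrow> nat" where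
  "rsb_at i \<pi> = card {j. j < length \<pi> \<and> (\<exists>l<j. i \<in> \<pi> ! l) \<and>
                         opener (\<pi> ! j) < i \<and> i < closer (\<pi> ! j)}"

definition rsb :: "nat \<Rightarrow> nat set list \<Rightarrow> nat" where
  "rsb n \<pi> = (\<Sum>i=1..n. rsb_at i \<pi>)"

text \<open>
  The natural-number subtractions below never truncate on \<open>OP n k\<close>: openers and closers
  lie in \<open>{1..n}\<close>.
\<close>

definition MAK :: "nat \<Rightarrow> nat set list \<Rightarrow> nat" where
  "MAK n \<pi> = rsb n \<pi> + (\<Sum>i\<in>Clos \<pi>. n - i)"

definition MAK' :: "nat \<Rightarrow> nat set list \<Rightarrow> nat" where
  "MAK' n \<pi> = rsb n \<pi> + (\<Sum>i\<in>Open \<pi>. i - 1)"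

end

theory Submission
  imports Defs
begin

text \<open>
  The complement \<open>x \<mapsto> n + 1 - x\<close> swaps MAK with MAK' and block descents with block ascents, so it
  suffices that block descents and block ascents (\<open>bASC = bREL (<)\<close> below) have the same distribution jointly with
  (MAK, MAK'). By inclusion-exclusion this only has to be checked for the events
  \<open>T \<subseteq> bDES \<pi>\<close> and \<open>T \<subseteq> bASC \<pi>\<close>. The set \<open>T\<close> cuts the positions into runs on which the blocks form
  a monotone chain; reversing every run exchanges the two events. Blocks of one chain do not
  contribute to rsb among each other, and blocks of different runs keep their relative order,
  so rsb, MAK and MAK' do not change.
\<close>

section \<open>Set-valued statistics determined by their superset counts\<close>

lemma card_eq_if_card_superset_eq:
  assumes A: "finite A" and U: "finite U"
    and f: "\<And>x. x \<in> A \<Longrightarrow> f x \<subseteq> U" and g: "\<And>x. x \<in> A \<Longrightarrow> g x \<subseteq> U"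
    and eq: "\<And>T. T \<subseteq> U \<Longrightarrow> card {x \<in> A. T \<subseteq> f x} = card {x \<in> A. T \<subseteq> g x}"
  shows "card {x \<in> A. f x = T} = card {x \<in> A. g x = T}"
proof (cases "T \<subseteq> U")
  case False
  then have "{x \<in> A. f x = T} = {}" "{x \<in> A. g x = T} = {}"
    using f g by auto
  then show ?thesis by (simp only:)
next
  case True
  \<comment> \<open>Sorting by the exact value of \<open>h\<close> isolates the wanted count from
    those of strictly larger sets, so no alternating signs are needed.\<close>
  have split: "card {x \<in> A. T \<subseteq> h x} =
      card {x \<in> A. h x = T} + (\<Sum>V\<in>{V. T \<subset> V \<and> V \<subseteq> U}. card {x \<in> A. h x = V})"
    if "\<And>x. x \<in> A \<Longrightarrow> h x \<subseteq> U" and T: "T \<subseteq> U" for h T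
  proof -
    have fin: "finite {V. T \<subset> V \<and> V \<subseteq> U}"
      using U by (rule_tac finite_subset[of _ "Pow U"]) auto
    have ins: "{V. T \<subseteq> V \<and> V \<subseteq> U} = insert T {V. T \<subset> V \<and> V \<subseteq> U}"
      using T by auto
    have "{x \<in> A. T \<subseteq> h x} = (\<Union>V\<in>{V. T \<subseteq> V \<and> V \<subseteq> U}. {x \<in> A. h x = V})"
      using that by auto
    also have "card \<dots> = (\<Sum>V\<in>{V. T \<subseteq> V \<and> V \<subseteq> U}. card {x \<in> A. h x = V})"
      using A fin by (intro card_UN_disjoint) (auto simp: ins)
    finally show ?thesis
      using fin by (simp add: ins)
  qed
  from True show ?thesis
  \<comment> \<open>Downward induction from \<open>U\<close>: the strictly larger sets are already
    settled, and subtracting their counts settles \<open>T\<close>.\<close>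
  proof (induction "card (U - T)" arbitrary: T rule: less_induct)
    case less
    have "card {x \<in> A. f x = V} = card {x \<in> A. g x = V}" if "T \<subset> V" "V \<subseteq> U" for V
      using that U less.prems by (intro less.hyps psubset_card_mono) auto
    then have "(\<Sum>V\<in>{V. T \<subset> V \<and> V \<subseteq> U}. card {x \<in> A. f x = V}) =
        (\<Sum>V\<in>{V. T \<subset> V \<and> V \<subseteq> U}. card {x \<in> A. g x = V})"
      by (intro sum.cong) auto
    then show ?case
      using split[OF f less.prems] split[OF g less.prems] eq[OF less.prems] by simp
  qed
qed

subsection \<open>Reversing the runs of a set of positions\<close>

text \<open>
  As in \<open>bDES\<close>, the element \<open>i\<close> of \<open>T\<close> links the list positions \<open>i - 1\<close> and \<open>i\<close>.
\<close>

definition linked :: "nat set \<Rightarrow> nat \<Rightarrow> nat \<Rightarrow> bool" where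
  "linked T p q \<longleftrightarrow> {min p q<..max p q} \<subseteq> T"

definition run :: "nat set \<Rightarrow> nat \<Rightarrow> nat \<Rightarrow> nat set" where
  "run T k p = {q. q < k \<and> linked T p q}"

text \<open>A run is an interval of positions; this is the reflection in its midpoint. For
  \<open>p < k\<close> the subtraction does not truncate, as \<open>p\<close> is at most the
  maximum.\<close>

definition run_mirror :: "nat set \<Rightarrow> nat \<Rightarrow> nat \<Rightarrow> nat" where
  "run_mirror T k p = Min (run T k p) + Max (run T k p) - p"

lemma linked_sym: "linked T p q \<Longrightarrow> linked T q p"
  by (simp add: linked_def min.commute max.commute)

text \<open>Wherever \<open>q\<close> lies, the steps between \<open>p\<close> and \<open>r\<close>
  are covered by those of the two detours through \<open>q\<close>. With symmetry, the runs become
  equivalence classes.\<close>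

lemma linked_trans:
  assumes "linked T p q" "linked T q r"
  shows "linked T p r"
proof -
  have "{min p r<..max p r} \<subseteq> {min p q<..max p q} \<union> {min q r<..max q r}"
    by auto
  then show ?thesis
    using assms unfolding linked_def by blast
qed

lemma linked_between: "linked T p r \<Longrightarrow> p \<le> q \<Longrightarrow> q \<le> r \<Longrightarrow> linked T p q"
  unfolding linked_def by auto

lemma finite_run: "finite (run T k p)"
  by (simp add: run_def)

lemma self_in_run: "p < k \<Longrightarrow> p \<in> run T k p"
  by (simp add: run_def linked_def)

lemma run_eq: "linked T p q \<Longrightarrow> run T k p = run T k q"
  unfolding run_def by (blast intro: linked_sym linked_trans)

lemma Min_run: "p < k \<Longrightarrow> Min (run T k p) \<in> run T k p \<and> Min (run T k p) \<le> p"
  using Min_in[OF finite_run] Min_le[OF finite_run self_in_run] self_in_run by blast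

lemma Max_run: "p < k \<Longrightarrow> Max (run T k p) \<in> run T k p \<and> p \<le> Max (run T k p)"
  using Max_in[OF finite_run] Max_ge[OF finite_run self_in_run] self_in_run by blast

text \<open>The ends of the run are linked through \<open>p\<close>, and the reflected position lies
  between them.\<close>

lemma run_mirror_in_run:
  assumes "p < k"
  shows "run_mirror T k p \<in> run T k p"
proof -
  let ?a = "Min (run T k p)" and ?b = "Max (run T k p)"
  have a: "linked T p ?a" "?a \<le> p" and b: "linked T p ?b" "p \<le> ?b" "?b < k"
    using Min_run[OF assms, of T] Max_run[OF assms, of T] by (auto simp: run_def)
  have "linked T ?a ?b"
    by (rule linked_trans[OF linked_sym[OF a(1)] b(1)])
  moreover have "?a \<le> run_mirror T k p" "run_mirror T k p \<le> ?b"
    using a b by (auto simp: run_mirror_def)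
  ultimately have "linked T ?a (run_mirror T k p)"
    by (rule linked_between)
  with a(1) have "linked T p (run_mirror T k p)"
    by (rule linked_trans)
  then show ?thesis
    using \<open>run_mirror T k p \<le> ?b\<close> b(3) by (simp add: run_def)
qed

lemma linked_run_mirror: "p < k \<Longrightarrow> linked T p (run_mirror T k p)"
  using run_mirror_in_run by (auto simp: run_def)

lemma run_mirror_less: "p < k \<Longrightarrow> run_mirror T k p < k"
  using run_mirror_in_run by (auto simp: run_def)

text \<open>Both reflections use the same centre because the mirrored position has the same
  run.\<close>

lemma run_mirror_run_mirror:
  assumes "p < k"
  shows "run_mirror T k (run_mirror T k p) = p"
  using run_eq[OF linked_run_mirror[OF assms], of T k] Min_run[OF assms, of T]
    Max_run[OF assms, of T]
  by (simp add: run_mirror_def)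

lemma linked_run_mirrors:
  assumes "p < k" "q < k"
  shows "linked T (run_mirror T k p) (run_mirror T k q) \<longleftrightarrow> linked T p q"
proof -
  have p: "linked T p (run_mirror T k p)" and q: "linked T q (run_mirror T k q)"
    using assms by (auto intro: linked_run_mirror)
  show ?thesis
    using linked_trans[OF p linked_trans[OF _ linked_sym[OF q]]]
      linked_trans[OF linked_sym[OF p] linked_trans[OF _ q]] by blast
qed

text \<open>Some \<open>x\<close> outside \<open>T\<close> separates two unlinked positions, and a
  position that moves only within its run cannot cross \<open>x\<close>.\<close>

lemma run_mirror_strict_mono:
  assumes "p < q" "q < k" "\<not> linked T p q"
  shows "run_mirror T k p < run_mirror T k q"
proof (rule ccontr)
  let ?p = "run_mirror T k p" and ?q = "run_mirror T k q"
  assume less: "\<not> ?p < ?q"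
  have p: "linked T p ?p" and q: "linked T q ?q"
    using assms by (auto intro: linked_run_mirror)
  from assms(3) obtain x where x: "p < x" "x \<le> q" "x \<notin> T"
    using assms(1) by (simp add: linked_def subset_iff) blast
  have "?p < x"
    using p x by (rule_tac ccontr) (auto simp: linked_def subset_iff)
  moreover have "x \<le> ?q"
    using q x by (rule_tac ccontr) (auto simp: linked_def subset_iff)
  ultimately show False
    using less by simp
qed

lemma run_mirror_pred:
  assumes "i \<in> T" "0 < i" "i < k"
  shows "run_mirror T k (i - 1) = Suc (run_mirror T k i)"
proof -
  have "{i - 1<..i} = {i}"
    using assms(2) by auto
  then have "linked T (i - 1) i"
    using assms(1) by (simp add: linked_def)
  then have "run T k (i - 1) = run T k i"
    by (rule run_eq)
  then show ?thesis
    using Min_run[OF assms(3), of T] Max_run[OF assms(3), of T] assms(2)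
    unfolding run_mirror_def by simp arith
qed

text \<open>The link \<open>i\<close> joins \<open>i - 1\<close> and \<open>i\<close>. Its mirror
  image joins \<open>run_mirror T k i\<close> to the next position, and a link is named by its right
  end.\<close>

lemma Suc_run_mirror_in:
  assumes "i \<in> T" "0 < i" "i < k"
  shows "Suc (run_mirror T k i) \<in> T"
proof -
  have "{i - 1<..i} = {i}"
    using assms(2) by auto
  then have "linked T (i - 1) i"
    using assms(1) by (simp add: linked_def)
  then have "linked T (run_mirror T k (i - 1)) (run_mirror T k i)"
    using assms by (simp add: linked_run_mirrors)
  then show ?thesis
    unfolding run_mirror_pred[OF assms] linked_def by auto
qed

definition rev_runs :: "nat set \<Rightarrow> 'a list \<Rightarrow> 'a list" where
  "rev_runs T xs = map (\<lambda>p. xs ! run_mirror T (length xs) p) [0..<length xs]"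

lemma length_rev_runs [simp]: "length (rev_runs T xs) = length xs"
  by (simp add: rev_runs_def)

lemma nth_rev_runs: "p < length xs \<Longrightarrow> rev_runs T xs ! p = xs ! run_mirror T (length xs) p"
  by (simp add: rev_runs_def)

lemma rev_runs_rev_runs: "rev_runs T (rev_runs T xs) = xs"
  by (rule nth_equalityI) (simp_all add: nth_rev_runs run_mirror_less run_mirror_run_mirror)

lemma set_rev_runs: "set (rev_runs T xs) = set xs"
proof -
  have "set (rev_runs T ys) \<subseteq> set ys" for ys :: "'a list"
    by (auto simp: rev_runs_def run_mirror_less)
  \<comment> \<open>Since reversal is an involution, the second instance is the opposite
    inclusion.\<close>
  from this[of xs] this[of "rev_runs T xs"] show ?thesis
    by (simp add: rev_runs_rev_runs)
qed

lemma distinct_rev_runs: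
  fixes xs :: "'a list"
  shows "distinct (rev_runs T xs) \<longleftrightarrow> distinct xs"
proof -
  have "distinct ys \<longleftrightarrow> card (set ys) = length ys" for ys :: "'a list"
    using card_distinct distinct_card by blast
  then show ?thesis
    by (simp add: set_rev_runs)
qed

lemma rev_runs_in_OP: "\<pi> \<in> OP n k \<Longrightarrow> rev_runs T \<pi> \<in> OP n k"
  by (simp add: OP_def set_rev_runs distinct_rev_runs)

subsection \<open>Chains of blocks\<close>

text \<open>The relation is a parameter so that descents \<open>(>)\<close> and ascents
  \<open>(<)\<close> share one treatment, with run reversal flipping it.\<close>

definition bREL :: "(nat \<Rightarrow> nat \<Rightarrow> bool) \<Rightarrow> nat set list \<Rightarrow> nat set" where
  "bREL R \<pi> = {i. 1 \<le> i \<and> i < length \<pi> \<and> (\<forall>x\<in>\<pi> ! (i - 1). \<forall>y\<in>\<pi> ! i. R x y)}"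

lemma bDES_eq_bREL: "bDES = bREL (>)"
  by (simp add: fun_eq_iff bDES_def bREL_def)

text \<open>With \<open>m\<close> the mirror of \<open>i\<close>, the blocks at \<open>i - 1\<close>
  and \<open>i\<close> of the reversed list are those of \<open>\<pi>\<close> at
  \<open>m + 1\<close> and \<open>m\<close>: neighbours in the opposite order.\<close>

lemma subset_bREL_rev_runs:
  assumes "T \<subseteq> bREL R \<pi>"
  shows "T \<subseteq> bREL (\<lambda>x y. R y x) (rev_runs T \<pi>)"
proof
  fix i assume i: "i \<in> T"
  then have i': "0 < i" "i < length \<pi>"
    using assms by (auto simp: bREL_def)
  then have "Suc (run_mirror T (length \<pi>) i) \<in> bREL R \<pi>"
    using Suc_run_mirror_in i assms by blast
  then show "i \<in> bREL (\<lambda>x y. R y x) (rev_runs T \<pi>)"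
    using i' run_mirror_pred[OF i i']
    by (simp add: bREL_def nth_rev_runs del: One_nat_def)
qed

text \<open>Comparisons of neighbouring blocks compose by transitivity through an element of the
  block in between; nonemptiness supplies that element.\<close>

lemma chain_if_subset_bREL:
  assumes R: "transp R" and T: "T \<subseteq> bREL R \<pi>" and ne: "{} \<notin> set \<pi>"
    and "p < q" "q < length \<pi>" "linked T p q" "x \<in> \<pi> ! p" "y \<in> \<pi> ! q"
  shows "R x y"
  using assms(4-8)
proof (induction q arbitrary: y)
  case (Suc q)
  have "Suc q \<in> T"
    using Suc.prems by (auto simp: linked_def)
  then have step: "R z y" if "z \<in> \<pi> ! q" for z
    using T Suc.prems that by (auto simp: bREL_def)
  show ?case
  proof (cases "p = q")
    case True
    then show ?thesis using step Suc.prems by simp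
  next
    case False
    have "\<pi> ! q \<noteq> {}"
      using ne Suc.prems(2) by (metis Suc_lessD nth_mem)
    then obtain z where z: "z \<in> \<pi> ! q"
      by blast
    have "R x z"
      using False Suc.prems z by (intro Suc.IH) (auto intro: linked_between)
    then show ?thesis
      using step[OF z] R by (meson transpD)
  qed
qed simp

section \<open>Invariance of rsb, MAK and MAK' under reversal of runs\<close>

lemma OP_D:
  assumes "\<pi> \<in> OP n k"
  shows "length \<pi> = k" "{} \<notin> set \<pi>" "\<And>B. B \<in> set \<pi> \<Longrightarrow> B \<subseteq> {1..n}"
    "\<And>B. B \<in> set \<pi> \<Longrightarrow> finite B"
proof -
  show sub: "B \<subseteq> {1..n}" if "B \<in> set \<pi>" for B
    using assms that by (auto simp: OP_def partition_on_def)
  show "finite B" if "B \<in> set \<pi>" for B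
    using sub[OF that] finite_subset by blast
qed (use assms in \<open>auto simp: OP_def partition_on_def\<close>)

text \<open>In a monotone chain, all of block \<open>q\<close> lies on one side of \<open>i\<close>,
  so its opener and closer cannot enclose \<open>i\<close>.\<close>

lemma not_straddled_if_linked:
  assumes \<pi>: "\<pi> \<in> OP n k" and T: "T \<subseteq> bREL (<) \<pi> \<or> T \<subseteq> bREL (>) \<pi>"
    and pq: "p < k" "q < k" "p \<noteq> q" "linked T p q"
    and i: "i \<in> \<pi> ! p" "opener (\<pi> ! q) < i" "i < closer (\<pi> ! q)"
  shows False
proof -
  have "\<pi> ! q \<in> set \<pi>"
    using OP_D(1)[OF \<pi>] pq(2) by auto
  then have "finite (\<pi> ! q)" "\<pi> ! q \<noteq> {}"
    using OP_D[OF \<pi>] by auto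
  then have q: "opener (\<pi> ! q) \<in> \<pi> ! q" "closer (\<pi> ! q) \<in> \<pi> ! q"
    by (simp_all add: opener_def closer_def)
  have chain: "(if p < q then R i y else R y i)"
    if "transp R" "T \<subseteq> bREL R \<pi>" "y \<in> \<pi> ! q" for R y
  proof (cases "p < q")
    case True
    then show ?thesis
      using chain_if_subset_bREL[OF that(1,2) _ True] that(3) pq i(1) OP_D(1,2)[OF \<pi>] by simp
  next
    case False
    then have "q < p"
      using pq(3) by simp
    then show ?thesis
      using chain_if_subset_bREL[OF that(1,2) _ \<open>q < p\<close>] that(3) pq i(1) OP_D(1,2)[OF \<pi>]
        linked_sym[OF pq(4)]
      by simp
  qed
  have tr: "transp ((<) :: nat \<Rightarrow> nat \<Rightarrow> bool)" "transp ((>) :: nat \<Rightarrow> nat \<Rightarrow> bool)"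
    by (auto intro: transpI)
  from T show False
  proof
    assume "T \<subseteq> bREL (<) \<pi>"
    from chain[OF tr(1) this q(1)] chain[OF tr(1) this q(2)] i(2,3) show False
      by (auto split: if_splits)
  next
    assume "T \<subseteq> bREL (>) \<pi>"
    from chain[OF tr(2) this q(1)] chain[OF tr(2) this q(2)] i(2,3) show False
      by (auto split: if_splits)
  qed
qed

text \<open>The mirror injects the blocks counted after reversal into those counted before. Only an
  inequality is needed, since reversal is an involution.\<close>

lemma rsb_at_rev_runs_le:
  assumes \<pi>: "\<pi> \<in> OP n k" and T: "T \<subseteq> bREL (<) \<pi> \<or> T \<subseteq> bREL (>) \<pi>"
  shows "rsb_at i (rev_runs T \<pi>) \<le> rsb_at i \<pi>"
  unfolding rsb_at_def length_rev_runs
proof (rule card_inj_on_le[where f = "run_mirror T k"])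
  have len: "length \<pi> = k"
    by (rule OP_D(1)[OF \<pi>])
  show "inj_on (run_mirror T k) {j. j < length \<pi> \<and> (\<exists>l<j. i \<in> rev_runs T \<pi> ! l) \<and>
      opener (rev_runs T \<pi> ! j) < i \<and> i < closer (rev_runs T \<pi> ! j)}"
    by (rule inj_on_inverseI[where g = "run_mirror T k"]) (auto simp: len run_mirror_run_mirror)
  show "run_mirror T k ` {j. j < length \<pi> \<and> (\<exists>l<j. i \<in> rev_runs T \<pi> ! l) \<and>
      opener (rev_runs T \<pi> ! j) < i \<and> i < closer (rev_runs T \<pi> ! j)}
    \<subseteq> {j. j < length \<pi> \<and> (\<exists>l<j. i \<in> \<pi> ! l) \<and> opener (\<pi> ! j) < i \<and> i < closer (\<pi> ! j)}"
  proof safe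
    fix j l
    assume j: "j < length \<pi>" "opener (rev_runs T \<pi> ! j) < i" "i < closer (rev_runs T \<pi> ! j)"
      and l: "l < j" "i \<in> rev_runs T \<pi> ! l"
    have jk: "j < k" "l < k"
      using j l len by auto
    let ?j = "run_mirror T k j" and ?l = "run_mirror T k l"
    have i: "i \<in> \<pi> ! ?l" "opener (\<pi> ! ?j) < i" "i < closer (\<pi> ! ?j)"
      using j l jk by (simp_all add: nth_rev_runs len)
    \<comment> \<open>Block \<open>j\<close> of the reversed list straddles \<open>i\<close>, so it
      lies in another run than the block of \<open>i\<close>; mirroring therefore keeps their
      order.\<close>
    have "\<not> linked T l j"
    proof
      assume "linked T l j"
      then have "linked T ?l ?j"
        using jk by (simp add: linked_run_mirrors)
      moreover have "?l \<noteq> ?j"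
        using l(1) jk run_mirror_run_mirror by (metis less_irrefl)
      ultimately show False
        using not_straddled_if_linked[OF \<pi> T] run_mirror_less jk i by blast
    qed
    then have "?l < ?j"
      using l(1) jk(1) by (rule_tac run_mirror_strict_mono)
    then show "\<exists>l<?j. i \<in> \<pi> ! l"
      using i by blast
    show "?j < length \<pi>" "opener (\<pi> ! ?j) < i" "i < closer (\<pi> ! ?j)"
      using i jk len run_mirror_less by auto
  qed
qed simp

lemma rsb_rev_runs:
  assumes \<pi>: "\<pi> \<in> OP n k" and T: "T \<subseteq> bREL (<) \<pi> \<or> T \<subseteq> bREL (>) \<pi>"
  shows "rsb n (rev_runs T \<pi>) = rsb n \<pi>"
proof -
  \<comment> \<open>Reversal exchanges the two alternatives, so the disjunction survives and the
    inequality applies to the reversed list as well.\<close>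
  have "T \<subseteq> bREL (<) (rev_runs T \<pi>) \<or> T \<subseteq> bREL (>) (rev_runs T \<pi>)"
    using T subset_bREL_rev_runs[of T "(<)" \<pi>] subset_bREL_rev_runs[of T "(>)" \<pi>] by blast
  from rsb_at_rev_runs_le[OF rev_runs_in_OP[OF \<pi>] this]
  have "rsb_at i \<pi> \<le> rsb_at i (rev_runs T \<pi>)" for i
    by (simp add: rev_runs_rev_runs)
  then show ?thesis
    unfolding rsb_def using rsb_at_rev_runs_le[OF \<pi> T] by (intro sum.cong refl antisym)
qed

lemma MAK_rev_runs:
  assumes "\<pi> \<in> OP n k" "T \<subseteq> bREL (<) \<pi> \<or> T \<subseteq> bREL (>) \<pi>"
  shows "MAK n (rev_runs T \<pi>) = MAK n \<pi>" "MAK' n (rev_runs T \<pi>) = MAK' n \<pi>"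
  by (simp_all add: MAK_def MAK'_def Clos_def Open_def set_rev_runs rsb_rev_runs[OF assms])

section \<open>Block descents against block ascents, jointly with MAK and MAK'\<close>

lemma card_subset_bDES_eq_bASC:
  "card {\<pi> \<in> {\<pi> \<in> OP n k. P (MAK n \<pi>) (MAK' n \<pi>)}. T \<subseteq> bREL (>) \<pi>} =
   card {\<pi> \<in> {\<pi> \<in> OP n k. P (MAK n \<pi>) (MAK' n \<pi>)}. T \<subseteq> bREL (<) \<pi>}"
proof (rule bij_betw_same_card[of "rev_runs T"], rule bij_betw_byWitness[of _ "rev_runs T"])
qed (auto simp: rev_runs_rev_runs rev_runs_in_OP MAK_rev_runs dest: subset_bREL_rev_runs)

lemma card_bDES_eq_bASC:
  "card {\<pi> \<in> {\<pi> \<in> OP n k. P (MAK n \<pi>) (MAK' n \<pi>)}. bREL (>) \<pi> = S} =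
   card {\<pi> \<in> {\<pi> \<in> OP n k. P (MAK n \<pi>) (MAK' n \<pi>)}. bREL (<) \<pi> = S}"
  by (rule card_eq_if_card_superset_eq[where U = "{..<k}", OF _ _ _ _ card_subset_bDES_eq_bASC])
    (auto simp: finite_OP bREL_def dest: OP_D(1))

subsection \<open>The complement\<close>

definition compl :: "nat \<Rightarrow> nat set list \<Rightarrow> nat set list" where
  "compl n \<pi> = map ((`) (\<lambda>x. n + 1 - x)) \<pi>"

lemma inj_on_reflect: "inj_on (\<lambda>x. n + 1 - x) {1..n::nat}"
  by (auto simp: inj_on_def)

lemma reflect_image: "(\<lambda>x. n + 1 - x) ` {1..n::nat} = {1..n}"
proof -
  have "x \<in> (\<lambda>x. n + 1 - x) ` {1..n}" if "x \<in> {1..n}" for x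
    using that by (intro image_eqI[of _ _ "n + 1 - x"]) auto
  then show ?thesis by auto
qed

lemma length_compl [simp]: "length (compl n \<pi>) = length \<pi>"
  by (simp add: compl_def)

lemma nth_compl: "j < length \<pi> \<Longrightarrow> compl n \<pi> ! j = (\<lambda>x. n + 1 - x) ` (\<pi> ! j)"
  by (simp add: compl_def)

lemma reflect_reflect_image:
  assumes "B \<subseteq> {1..n::nat}"
  shows "(\<lambda>x. n + 1 - x) ` (\<lambda>x. n + 1 - x) ` B = B"
proof -
  have "(\<lambda>x. n + 1 - x) ` (\<lambda>x. n + 1 - x) ` B = id ` B"
    unfolding image_image using assms by (intro image_cong) auto
  then show ?thesis by simp
qed

lemma compl_compl: "\<pi> \<in> OP n k \<Longrightarrow> compl n (compl n \<pi>) = \<pi>"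
  unfolding compl_def using OP_D(3)
  by (auto intro!: map_idI simp: reflect_reflect_image simp del: One_nat_def Suc_eq_plus1)

lemma compl_in_OP:
  assumes "\<pi> \<in> OP n k"
  shows "compl n \<pi> \<in> OP n k"
proof -
  have part: "partition_on {1..n} (set \<pi>)" and d: "distinct \<pi>"
    using assms by (auto simp: OP_def)
  then have "set \<pi> \<subseteq> Pow {1..n}"
    by (auto simp: partition_on_def)
  \<comment> \<open>Distinct blocks must have distinct images: injectivity on points lifts to
    subsets of \<open>{1..n}\<close>.\<close>
  then have "inj_on ((`) (\<lambda>x. n + 1 - x)) (set \<pi>)"
    using inj_on_image_Pow[OF inj_on_reflect] inj_on_subset by blast
  then have "distinct (compl n \<pi>)"
    using d unfolding compl_def by (simp only: distinct_map)
  moreover have "partition_on {1..n} (set (compl n \<pi>))"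
  proof -
    have "{} \<notin> set (compl n \<pi>)"
      using part by (auto simp: compl_def partition_on_def)
    then show ?thesis
      using partition_on_inj_image[OF part inj_on_reflect]
      by (simp add: compl_def reflect_image del: One_nat_def)
  qed
  ultimately show ?thesis
    using assms by (simp add: OP_def)
qed

text \<open>The reflection reverses the order, so minimum and maximum trade places. The two bounds
  keep later subtractions exact.\<close>

lemma reflect_bounds:
  assumes "B \<noteq> {}" "B \<subseteq> {1..n}"
  shows "opener ((\<lambda>x. n + 1 - x) ` B) = n + 1 - closer B"
    "closer ((\<lambda>x. n + 1 - x) ` B) = n + 1 - opener B"
    "opener B \<in> {1..n}" "closer B \<in> {1..n}"
proof -
  have fin: "finite B"
    using assms(2) finite_subset by blast
  then have min: "Min B \<in> B" and max: "Max B \<in> B"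
    using assms(1) by auto
  then show "opener B \<in> {1..n}" "closer B \<in> {1..n}"
    using assms(2) by (auto simp only: opener_def closer_def)
  show "opener ((\<lambda>x. n + 1 - x) ` B) = n + 1 - closer B"
    "closer ((\<lambda>x. n + 1 - x) ` B) = n + 1 - opener B"
    using fin min max unfolding opener_def closer_def
    by (auto intro!: Min_eqI Max_eqI diff_le_mono2 imageI simp del: One_nat_def)
qed

text \<open>Blocks keep their positions while opener and closer trade roles, and straddling is
  symmetric in the two.\<close>

lemma rsb_at_compl:
  assumes \<pi>: "\<pi> \<in> OP n k" and i: "i \<in> {1..n}"
  shows "rsb_at (n + 1 - i) (compl n \<pi>) = rsb_at i \<pi>"
proof -
  have mem: "n + 1 - i \<in> compl n \<pi> ! l \<longleftrightarrow> i \<in> \<pi> ! l" if l: "l < length \<pi>" for l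
  proof -
    have "\<pi> ! l \<subseteq> {1..n}"
      using OP_D(3)[OF \<pi>] l by simp
    then show ?thesis
      using inj_on_image_mem_iff[OF inj_on_reflect i] l by (simp add: nth_compl)
  qed
  have str: "opener (compl n \<pi> ! j) < n + 1 - i \<and> n + 1 - i < closer (compl n \<pi> ! j) \<longleftrightarrow>
      opener (\<pi> ! j) < i \<and> i < closer (\<pi> ! j)" if j: "j < length \<pi>" for j
  proof -
    have "\<pi> ! j \<in> set \<pi>"
      using j by simp
    then have "\<pi> ! j \<noteq> {}" "\<pi> ! j \<subseteq> {1..n}"
      using OP_D(2,3)[OF \<pi>] by metis+
    from reflect_bounds[OF this] show ?thesis
      unfolding nth_compl[OF j] using i by auto
  qed
  have "(\<exists>l<j. n + 1 - i \<in> compl n \<pi> ! l) \<longleftrightarrow> (\<exists>l<j. i \<in> \<pi> ! l)" if "j < length \<pi>" for j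
    using mem that less_trans by blast
  then show ?thesis
    unfolding rsb_at_def length_compl by (intro arg_cong[of _ _ card] Collect_cong) (metis str)
qed

lemma rsb_compl:
  assumes "\<pi> \<in> OP n k"
  shows "rsb n (compl n \<pi>) = rsb n \<pi>"
proof -
  have "rsb n (compl n \<pi>) = (\<Sum>i\<in>(\<lambda>x. n + 1 - x) ` {1..n}. rsb_at i (compl n \<pi>))"
    by (simp only: rsb_def reflect_image)
  also have "\<dots> = rsb n \<pi>"
    unfolding sum.reindex[OF inj_on_reflect] rsb_def comp_def
    using assms by (intro sum.cong refl rsb_at_compl)
  finally show ?thesis .
qed

text \<open>A closer \<open>c\<close> becomes the opener \<open>n + 1 - c\<close>, whose
  contribution \<open>(n + 1 - c) - 1\<close> is the term \<open>n - c\<close> of MAK.\<close>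

lemma MAK'_compl:
  assumes \<pi>: "\<pi> \<in> OP n k"
  shows "MAK' n (compl n \<pi>) = MAK n \<pi>"
proof -
  have "Open (compl n \<pi>) = (\<lambda>x. n + 1 - x) ` Clos \<pi>"
    unfolding Open_def Clos_def compl_def set_map image_image
    using OP_D(2,3)[OF \<pi>] by (intro image_cong refl reflect_bounds(1)) auto
  moreover have "Clos \<pi> \<subseteq> {1..n}"
    unfolding Clos_def using OP_D(2,3)[OF \<pi>] reflect_bounds(4) by (metis image_subsetI)
  ultimately have "(\<Sum>i\<in>Open (compl n \<pi>). i - 1) = (\<Sum>i\<in>Clos \<pi>. n - i)"
    using sum.reindex[OF inj_on_subset[OF inj_on_reflect], of "Clos \<pi>" n "\<lambda>i. i - 1"]
    by (simp add: comp_def)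
  then show ?thesis
    by (simp add: MAK_def MAK'_def rsb_compl[OF \<pi>])
qed

lemma MAK_compl: "\<pi> \<in> OP n k \<Longrightarrow> MAK n (compl n \<pi>) = MAK' n \<pi>"
  using MAK'_compl[OF compl_in_OP] by (metis compl_compl)

lemma bREL_compl:
  assumes \<pi>: "\<pi> \<in> OP n k"
  shows "bREL (>) (compl n \<pi>) = bREL (<) \<pi>"
proof -
  have "n + 1 - y < n + 1 - x \<longleftrightarrow> x < y"
    if "x \<in> \<pi> ! l" "y \<in> \<pi> ! j" "l < length \<pi>" "j < length \<pi>" for x y l j
  proof -
    have "x \<in> {1..n}" "y \<in> {1..n}"
      using that OP_D(3)[OF \<pi>] nth_mem by blast+
    then show ?thesis by auto
  qed
  then have "(\<forall>x\<in>compl n \<pi> ! (i - 1). \<forall>y\<in>compl n \<pi> ! i. y < x) \<longleftrightarrow>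
      (\<forall>x\<in>\<pi> ! (i - 1). \<forall>y\<in>\<pi> ! i. x < y)" if "i < length \<pi>" for i
    using that by (simp add: nth_compl)
  then show ?thesis
    by (auto simp: bREL_def simp del: One_nat_def)
qed

theorem theorem1p9:
  fixes n k :: nat and a b :: int and S :: "nat set"
  assumes "1 \<le> k" and "k \<le> n" and "S \<subseteq> {1..}"
  shows "card {\<pi> \<in> OP n k. (int (MAK n \<pi>), int (MAK' n \<pi>), bDES \<pi>) = (a, b, S)} =
         card {\<pi> \<in> OP n k. (int (MAK' n \<pi>), int (MAK n \<pi>), bDES \<pi>) = (a, b, S)}"
proof -
  have "card {\<pi> \<in> OP n k. (int (MAK n \<pi>), int (MAK' n \<pi>), bDES \<pi>) = (a, b, S)} =
      card {\<pi> \<in> OP n k. int (MAK n \<pi>) = a \<and> int (MAK' n \<pi>) = b \<and> bREL (<) \<pi> = S}"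
    \<comment> \<open>The predicate fixes both statistics, so only descents turn into ascents here;
      the complement then swaps the statistics and restores descents.\<close>
    using card_bDES_eq_bASC[of n k "\<lambda>x y. int x = a \<and> int y = b" S]
    by (simp add: bDES_eq_bREL conj_assoc)
  also have "\<dots> = card {\<pi> \<in> OP n k. (int (MAK' n \<pi>), int (MAK n \<pi>), bDES \<pi>) = (a, b, S)}"
  proof (rule bij_betw_same_card[of "compl n"], rule bij_betw_byWitness[of _ "compl n"])
    \<comment> \<open>The converse exchange comes from applying \<open>bREL_compl\<close> to the
      complement itself.\<close>
    have "bREL (<) (compl n \<pi>) = bREL (>) \<pi>" if "\<pi> \<in> OP n k" for \<pi>
      using bREL_compl[OF compl_in_OP[OF that]] by (simp add: compl_compl[OF that])
    then show "compl n ` {\<pi> \<in> OP n k. (int (MAK' n \<pi>), int (MAK n \<pi>), bDES \<pi>) = (a, b, S)}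
        \<subseteq> {\<pi> \<in> OP n k. int (MAK n \<pi>) = a \<and> int (MAK' n \<pi>) = b \<and> bREL (<) \<pi> = S}"
      by (auto simp: bDES_eq_bREL compl_in_OP MAK_compl MAK'_compl)
  qed (auto simp: bDES_eq_bREL compl_compl compl_in_OP MAK_compl MAK'_compl bREL_compl)
  finally show ?thesis .
qed

end
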